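(* Let $m$ be a positive integer and $a_1,\dots,a_m\in\mathbb{Z}$. The quadratic form $\sum_{i=1}^{m}a_iX_i^2$ is universal over $M_2(\mathbb{Z})$ if and only if both of the following hold: (i) there is no prime $p$ which divides $m-1$ of the numbers $a_1,\dots,a_m$ (i.e. no prime divides $a_i$ for at least $m-1$ indices $i$); and (ii) there exist three distinct indices $i,j,k$ such that none of $a_i,a_j,a_k$ is a multiple of $4$.
   Context: A form $\sum_{i=1}^{m}a_iX_i^2$ with integer coefficients is called universal over $M_n(\mathbb{Z})$ (the ring of $n\times n$ integer matrices) if for every $A\in M_n(\mathbb{Z})$ there exist $X_1,\dots,X_m\in M_n(\mathbb{Z})$ with $A=\sum_{i=1}^{m}a_iX_i^2$. *)

theory Defs
  imports "HOL-Analysis.Analysis" "HOL-Computational_Algebra.Primes"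
begin

definition int_mat_scale :: "int \<Rightarrow> int ^ 'n ^ 'm \<Rightarrow> int ^ 'n ^ 'm" where
  "int_mat_scale c X = (\<chi> i j. c * X $ i $ j)"

(* The square is the matrix product X ** X: the library's * and ^ on vectors act componentwise.
   The type argument fixes the matrix size n = CARD('n). *)
definition universal_over_int_mat :: "'n::finite itself \<Rightarrow> nat \<Rightarrow> (nat \<Rightarrow> int) \<Rightarrow> bool" where
  "universal_over_int_mat (_ :: 'n itself) m a \<longleftrightarrow>
     (\<forall>A :: int ^ 'n ^ 'n. \<exists>X :: nat \<Rightarrow> int ^ 'n ^ 'n.
        A = (\<Sum>i=1..m. int_mat_scale (a i) (X i ** X i)))"

end

theory Submission
  imports Defs "HOL-Number_Theory.Cong"
begin

text \<open>
  Write the unknown matrices as [[x, b], [c, t - x]]. Once the traces t and the entries c are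
  chosen, the equations for the entry q in position (1,2) and for the difference of the diagonal
  entries are linear in b and x, and so is the equation for the entry in position (1,1) when b is
  the last unknown. The system is solvable if the 2 by 2 minors of the rows (a t) and (a c) are
  coprime, up to a parity condition on the traces. By (i), two coefficients are units modulo each
  prime, which allows t and c to be chosen modulo each relevant prime; these choices are glued by
  the Chinese remainder theorem, and one remaining entry absorbs the equation for position (2,1).
  The prime 2 needs a third odd coefficient, an odd entry outside the diagonal, or, when the matrix
  is scalar modulo 2, even traces; in the last case a coefficient congruent to 2 modulo 4 with odd
  trace corrects the difference of the diagonal entries modulo 4.

  Conversely, if (i) fails at p then [[0, 1], [0, 0]] would be a multiple of a square modulo p. If
  only two coefficients u and v are not multiples of 4, they are odd by (i), and diag(h, h + 2) with
  h = (u + v) / 2 is not represented modulo 4.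
\<close>

section \<open>Integer ideals and surjectivity of two-row integer systems\<close>

text \<open>The least positive element of \<open>H\<close> divides all of \<open>H\<close> by
  division with remainder, so a prime factor of it would divide every element, against
  \<open>prime\<close>.\<close>

lemma int_ideal_contains_one:
  fixes H :: "int set"
  assumes diff: "\<And>g h. g \<in> H \<Longrightarrow> h \<in> H \<Longrightarrow> g - h \<in> H"
    and mult: "\<And>g k. g \<in> H \<Longrightarrow> k * g \<in> H"
    and prime: "\<And>p::nat. prime p \<Longrightarrow> \<exists>h\<in>H. \<not> int p dvd h"
  shows "1 \<in> H"
proof -
  \<comment> \<open>The prime 2 serves here to produce a nonzero element.\<close>
  obtain h where h: "h \<in> H" "\<not> int 2 dvd h"
    using prime[OF two_is_prime_nat] by blast
  have "h \<noteq> 0" using h by auto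
  have "\<bar>h\<bar> \<in> H" using h mult[of h 1] mult[of h "-1"] by (auto simp: abs_if)
  then have ex: "\<exists>n. 0 < n \<and> int n \<in> H"
    using \<open>h \<noteq> 0\<close> by (intro exI[of _ "nat \<bar>h\<bar>"]) auto
  define n where "n = (LEAST n. 0 < n \<and> int n \<in> H)"
  have n: "0 < n" "int n \<in> H"
    using LeastI_ex[OF ex] unfolding n_def by auto
  have dvd: "int n dvd g" if g: "g \<in> H" for g
  proof (rule ccontr)
    assume "\<not> int n dvd g"
    then have pos: "0 < g mod int n"
      using n pos_mod_sign[of "int n" g] dvd_eq_mod_eq_0[of "int n" g] by linarith
    have "g mod int n = g - (g div int n) * int n"
      by (simp add: minus_div_mult_eq_mod)
    then have "g mod int n \<in> H" using diff[OF g mult[OF n(2)]] by simp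
    then have "n \<le> nat (g mod int n)"
      using pos Least_le[of "\<lambda>n. 0 < n \<and> int n \<in> H" "nat (g mod int n)"]
      unfolding n_def[symmetric] by simp
    then show False using n pos pos_mod_bound[of "int n" g] by linarith
  qed
  have "n = 1"
  proof (rule ccontr)
    assume "n \<noteq> 1"
    then obtain p where "prime p" "p dvd n" using prime_factor_nat by blast
    with dvd prime show False by (meson dvd_trans int_dvd_int_iff)
  qed
  with n show ?thesis by simp
qed

text \<open>The integers \<open>h\<close> for which every vector (h y, h z) is attained form an
  ideal. Cramer's rule puts all the minors into it, and no prime divides all of these, so it
  contains 1.\<close>

lemma coprime_minors_surj:
  fixes u v :: "'i \<Rightarrow> int"
  assumes fin: "finite I"
    and minors: "\<And>p::nat. prime p \<Longrightarrow> \<exists>i\<in>I. \<exists>j\<in>I. \<not> int p dvd u i * v j - u j * v i"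
  shows "\<exists>b. (\<Sum>i\<in>I. u i * b i) = y \<and> (\<Sum>i\<in>I. v i * b i) = z"
proof -
  define H where "H = {h. \<forall>y z. \<exists>b. (\<Sum>i\<in>I. u i * b i) = h * y \<and> (\<Sum>i\<in>I. v i * b i) = h * z}"
  have "1 \<in> H"
  proof (rule int_ideal_contains_one)
    fix g h assume gh: "g \<in> H" "h \<in> H"
    show "g - h \<in> H" unfolding H_def
    proof (intro CollectI allI)
      fix y z
      obtain b where b: "(\<Sum>i\<in>I. u i * b i) = g * y" "(\<Sum>i\<in>I. v i * b i) = g * z"
        using gh unfolding H_def by blast
      obtain c where c: "(\<Sum>i\<in>I. u i * c i) = h * y" "(\<Sum>i\<in>I. v i * c i) = h * z"
        using gh unfolding H_def by blast
      show "\<exists>b. (\<Sum>i\<in>I. u i * b i) = (g - h) * y \<and> (\<Sum>i\<in>I. v i * b i) = (g - h) * z"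
        by (rule exI[of _ "\<lambda>i. b i - c i"])
          (simp add: algebra_simps sum_subtractf b[simplified algebra_simps] c[simplified algebra_simps])
    qed
  next
    fix g k assume g: "g \<in> H"
    show "k * g \<in> H" unfolding H_def
    proof (intro CollectI allI)
      fix y z
      obtain b where "(\<Sum>i\<in>I. u i * b i) = g * (k * y)" "(\<Sum>i\<in>I. v i * b i) = g * (k * z)"
        using g unfolding H_def by blast
      then show "\<exists>b. (\<Sum>i\<in>I. u i * b i) = k * g * y \<and> (\<Sum>i\<in>I. v i * b i) = k * g * z"
        by (auto simp: mult_ac)
    qed
  next
    fix p :: nat assume "prime p"
    then obtain i j where ij: "i \<in> I" "j \<in> I" "\<not> int p dvd u i * v j - u j * v i"
      using minors by blast
    have "u i * v j - u j * v i \<in> H" unfolding H_def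
    proof (intro CollectI allI)
      fix y z
      \<comment> \<open>Cramer's solution supported on the columns \<open>i\<close> and
        \<open>j\<close>, without the division by the determinant.\<close>
      let ?b = "\<lambda>k. (y * v j - z * u j) * (if k = i then 1 else 0)
        + (z * u i - y * v i) * (if k = j then 1 else 0)"
      have eval: "(\<Sum>k\<in>I. w k * ?b k) = (y * v j - z * u j) * w i + (z * u i - y * v i) * w j" for w
      proof -
        have "(\<Sum>k\<in>I. w k * ?b k) = (\<Sum>k\<in>I. if k = i then (y * v j - z * u j) * w i else 0)
            + (\<Sum>k\<in>I. if k = j then (z * u i - y * v i) * w j else 0)"
          unfolding sum.distrib[symmetric] by (intro sum.cong) (auto simp: algebra_simps)
        then show ?thesis using fin ij by simp
      qed
      show "\<exists>b. (\<Sum>k\<in>I. u k * b k) = (u i * v j - u j * v i) * y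
          \<and> (\<Sum>k\<in>I. v k * b k) = (u i * v j - u j * v i) * z"
      proof (rule exI[of _ ?b], intro conjI)
        show "(\<Sum>k\<in>I. u k * ?b k) = (u i * v j - u j * v i) * y"
          unfolding eval by (simp add: algebra_simps)
        show "(\<Sum>k\<in>I. v k * ?b k) = (u i * v j - u j * v i) * z"
          unfolding eval by (simp add: algebra_simps)
      qed
    qed
    with ij show "\<exists>h\<in>H. \<not> int p dvd h" by blast
  qed
  then have "\<exists>b. (\<Sum>i\<in>I. u i * b i) = 1 * y \<and> (\<Sum>i\<in>I. v i * b i) = 1 * z"
    unfolding H_def by blast
  then show ?thesis by simp
qed

section \<open>Passing between prime powers and integers\<close>

lemma chinese_remainder_prime_powers_int:
  fixes f :: "nat \<Rightarrow> int"
  assumes "finite P" "\<And>p. p \<in> P \<Longrightarrow> prime p"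
  shows "\<exists>x. \<forall>p\<in>P. [x = f p] (mod int p ^ k p)"
proof -
  \<comment> \<open>Targets are replaced by their nonnegative residues, to which the theorem for
    natural numbers applies.\<close>
  have "\<exists>x. \<forall>p\<in>P. [x = nat (f p mod int (p ^ k p))] (mod p ^ k p)"
    using assms by (intro chinese_remainder_nat) (auto simp: primes_coprime)
  then obtain x where x: "\<forall>p\<in>P. [x = nat (f p mod int (p ^ k p))] (mod p ^ k p)" by blast
  have "[int x = f p] (mod int p ^ k p)" if "p \<in> P" for p
  proof -
    have "p ^ k p > 0" using assms that by (simp add: prime_gt_0_nat)
    then have nn: "0 \<le> f p mod int (p ^ k p)" by (intro pos_mod_sign) simp
    have "[int x = int (nat (f p mod int (p ^ k p)))] (mod int (p ^ k p))"
      using x that by (simp only: cong_int_iff)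
    then show ?thesis using nn by (simp add: cong_def)
  qed
  then show ?thesis by blast
qed

text \<open>Serves to assemble divisibility by \<open>\<alpha> j1\<close>, which the local choices
  give one prime at a time, by comparing multiplicities.\<close>

lemma dvd_if_prime_powers_dvd_int:
  fixes x y :: int
  assumes "x \<noteq> 0"
    and pow: "\<And>p::nat. prime p \<Longrightarrow> int p dvd x \<Longrightarrow> int p ^ multiplicity (int p) x dvd y"
  shows "x dvd y"
proof (cases "y = 0")
  case False
  show ?thesis
  proof (rule multiplicity_le_imp_dvd[OF assms(1)])
    fix p :: int assume p: "prime p"
    then obtain n where n: "p = int n" by (metis nonneg_int_cases prime_ge_0_int)
    with p have "prime n" by simp
    show "multiplicity p x \<le> multiplicity p y"
    proof (cases "p dvd x")
      case True
      then have "p ^ multiplicity p x dvd y" using pow[OF \<open>prime n\<close>] n by simp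
      then show ?thesis using p False by (intro multiplicity_geI) auto
    qed (simp add: not_dvd_imp_multiplicity_0)
  qed
qed simp

section \<open>Choice of the two coefficient rows, first at one prime, then globally\<close>

text \<open>
  The position j2 has s = 0 and r = 1, so it does not contribute to the sum of the
  \<open>\<alpha> j * s j * r j\<close>; at j1, where s = 1, the value of r is left to be determined by that sum,
  which is only possible if \<open>\<alpha> j1\<close> divides what the other terms leave.
\<close>

lemma exists_local_rows:
  fixes \<alpha> \<epsilon> :: "'i \<Rightarrow> int" and p :: nat
  assumes fin: "finite J" and p: "prime p" and j1: "j1 \<notin> J" and j2: "j2 \<notin> J"
    and dvd: "int p dvd \<alpha> j1 * \<alpha> j2"
    and units: "\<exists>i\<in>insert j1 (insert j2 J). \<exists>j\<in>insert j1 (insert j2 J).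
      i \<noteq> j \<and> \<not> int p dvd \<alpha> i \<and> \<not> int p dvd \<alpha> j"
    and \<epsilon>: "\<And>j. j \<in> insert j2 J \<Longrightarrow> \<not> int p dvd \<epsilon> j"
  shows "\<exists>\<sigma> \<rho>. (int p dvd \<alpha> j1 \<longrightarrow> int p ^ k dvd C - (\<Sum>j\<in>J. \<alpha> j * \<sigma> j * \<rho> j)) \<and>
    (\<forall>s r. s j1 = 1 \<and> s j2 = 0 \<and> r j2 = 1 \<and>
      (\<forall>j\<in>J. [s j = \<sigma> j] (mod int p) \<and> [r j = \<rho> j] (mod int p)) \<longrightarrow>
      (\<exists>i\<in>insert j1 (insert j2 J). \<exists>j\<in>insert j1 (insert j2 J).
         \<not> int p dvd (\<alpha> i * s i) * (\<alpha> j * \<epsilon> j * r j) - (\<alpha> j * s j) * (\<alpha> i * \<epsilon> i * r i)))"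
proof -
  let ?I = "insert j1 (insert j2 J)"
  have pi: "prime (int p)" using p by simp
  have minor: "\<not> int p dvd (\<alpha> i * s i) * (\<alpha> j * \<epsilon> j * r j) - (\<alpha> j * s j) * (\<alpha> i * \<epsilon> i * r i)"
    if "\<not> int p dvd \<alpha> i" "\<not> int p dvd \<alpha> j" "j \<in> insert j2 J"
      "[s i = 1] (mod int p)" "[s j = 0] (mod int p)" "[r j = 1] (mod int p)"
    for i j and s r :: "'i \<Rightarrow> int"
  proof -
    have "[(\<alpha> i * s i) * (\<alpha> j * \<epsilon> j * r j) - (\<alpha> j * s j) * (\<alpha> i * \<epsilon> i * r i)
        = (\<alpha> i * 1) * (\<alpha> j * \<epsilon> j * 1) - (\<alpha> j * 0) * (\<alpha> i * \<epsilon> i * r i)] (mod int p)"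
      using that by (intro cong_diff cong_mult cong_refl)
    moreover have "\<not> int p dvd \<alpha> i * (\<alpha> j * \<epsilon> j)"
      using that \<epsilon>[of j] by (simp add: prime_dvd_mult_iff[OF pi])
    ultimately show ?thesis by (simp add: cong_dvd_iff)
  qed
  have inverse: "\<exists>x. int p ^ k dvd C - \<alpha> j * x" if "\<not> int p dvd \<alpha> j" for j
  proof -
    have "coprime (\<alpha> j) (int p ^ k)"
      using that pi by (simp add: prime_imp_coprime coprime_commute)
    then obtain y where "[\<alpha> j * y = 1] (mod int p ^ k)" by (meson cong_solve_coprime_int)
    then have "[C * (\<alpha> j * y) = C * 1] (mod int p ^ k)" by (intro cong_mult cong_refl)
    then have "int p ^ k dvd C - \<alpha> j * (C * y)"
      by (metis cong_iff_dvd_diff cong_sym mult.right_neutral mult.left_commute)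
    then show ?thesis by blast
  qed
  have delta: "(\<Sum>j\<in>J. \<alpha> j * (if j = i then 1 else 0) * \<rho> j) = \<alpha> i * \<rho> i"
    if "i \<in> J" for i and \<rho> :: "'i \<Rightarrow> int"
  proof -
    have "(\<Sum>j\<in>J. \<alpha> j * (if j = i then 1 else 0) * \<rho> j) = (\<Sum>j\<in>J. if j = i then \<alpha> i * \<rho> i else 0)"
      by (intro sum.cong) auto
    then show ?thesis using fin that by simp
  qed
  \<comment> \<open>Since \<open>p\<close> divides \<open>\<alpha> j1 * \<alpha> j2\<close>, at most
    one of these two is a unit, so at least one unit lies in \<open>J\<close>. The congruence for
    \<open>C\<close> is required only in the last two cases, where a unit of \<open>J\<close>
    absorbs it.\<close>
  consider j where "\<not> int p dvd \<alpha> j1" "j \<in> J" "\<not> int p dvd \<alpha> j"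
    | j where "int p dvd \<alpha> j1" "\<not> int p dvd \<alpha> j2" "j \<in> J" "\<not> int p dvd \<alpha> j"
    | i j where "int p dvd \<alpha> j1" "i \<in> J" "j \<in> J" "i \<noteq> j" "\<not> int p dvd \<alpha> i" "\<not> int p dvd \<alpha> j"
    using units dvd unfolding prime_dvd_mult_iff[OF pi] by blast
  then show ?thesis
  proof cases
    case 1
    show ?thesis
    proof (rule exI[of _ "\<lambda>_. 0"], rule exI[of _ "\<lambda>_. 1"], intro conjI allI impI)
      fix s r :: "'i \<Rightarrow> int"
      assume h: "s j1 = 1 \<and> s j2 = 0 \<and> r j2 = 1 \<and> (\<forall>j\<in>J. [s j = 0] (mod int p) \<and> [r j = 1] (mod int p))"
      have "\<not> int p dvd (\<alpha> j1 * s j1) * (\<alpha> j * \<epsilon> j * r j) - (\<alpha> j * s j) * (\<alpha> j1 * \<epsilon> j1 * r j1)"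
        using h 1 by (intro minor) auto
      with 1 show "\<exists>i\<in>?I. \<exists>j\<in>?I.
          \<not> int p dvd (\<alpha> i * s i) * (\<alpha> j * \<epsilon> j * r j) - (\<alpha> j * s j) * (\<alpha> i * \<epsilon> i * r i)"
        by blast
    qed (use 1 in auto)
  next
    case 2
    obtain x where x: "int p ^ k dvd C - \<alpha> j * x" using inverse 2 by blast
    \<comment> \<open>\<open>j\<close> carries all of \<open>C\<close> and gives the column with s =
      1; \<open>j2\<close> gives the one with s = 0.\<close>
    show ?thesis
    proof (rule exI[of _ "\<lambda>i. if i = j then 1 else 0"], rule exI[of _ "\<lambda>_. x"], intro conjI allI impI)
      fix s r :: "'i \<Rightarrow> int"
      assume h: "s j1 = 1 \<and> s j2 = 0 \<and> r j2 = 1 \<and>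
        (\<forall>i\<in>J. [s i = (if i = j then 1 else 0)] (mod int p) \<and> [r i = x] (mod int p))"
      then have "[s j = 1] (mod int p)" using 2 by auto
      then have "\<not> int p dvd (\<alpha> j * s j) * (\<alpha> j2 * \<epsilon> j2 * r j2) - (\<alpha> j2 * s j2) * (\<alpha> j * \<epsilon> j * r j)"
        using h 2 by (intro minor) auto
      with 2 show "\<exists>i\<in>?I. \<exists>j\<in>?I.
          \<not> int p dvd (\<alpha> i * s i) * (\<alpha> j * \<epsilon> j * r j) - (\<alpha> j * s j) * (\<alpha> i * \<epsilon> i * r i)"
        by blast
    qed (use x 2 delta[of j "\<lambda>_. x"] in simp)
  next
    case 3
    obtain x where x: "int p ^ k dvd C - \<alpha> i * x" using inverse 3 by blast
    let ?\<rho> = "\<lambda>l. if l = i then x else 1"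
    \<comment> \<open>\<open>i\<close> carries \<open>C\<close>, while \<open>j\<close> is left free
      to have s = 0 and r = 1.\<close>
    show ?thesis
    proof (rule exI[of _ "\<lambda>l. if l = i then 1 else 0"], rule exI[of _ ?\<rho>], intro conjI allI impI)
      fix s r :: "'i \<Rightarrow> int"
      assume h: "s j1 = 1 \<and> s j2 = 0 \<and> r j2 = 1 \<and>
        (\<forall>l\<in>J. [s l = (if l = i then 1 else 0)] (mod int p) \<and> [r l = ?\<rho> l] (mod int p))"
      then have "[s i = 1] (mod int p)" "[s j = 0] (mod int p)" "[r j = 1] (mod int p)"
        using 3 by (metis (full_types))+
      then have "\<not> int p dvd (\<alpha> i * s i) * (\<alpha> j * \<epsilon> j * r j) - (\<alpha> j * s j) * (\<alpha> i * \<epsilon> i * r i)"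
        using 3 by (intro minor) auto
      with 3 show "\<exists>i\<in>?I. \<exists>j\<in>?I.
          \<not> int p dvd (\<alpha> i * s i) * (\<alpha> j * \<epsilon> j * r j) - (\<alpha> j * s j) * (\<alpha> i * \<epsilon> i * r i)"
        by blast
    qed (use x 3 delta[of i ?\<rho>] in simp)
  qed
qed

text \<open>
  The factors \<open>\<epsilon>\<close> are 1 except in the case of a matrix that is scalar modulo 2, where the factor 2
  of a coefficient congruent to 2 modulo 4 occurs in only one of the two rows.
\<close>

lemma exists_global_rows:
  fixes \<alpha> \<epsilon> :: "'i \<Rightarrow> int"
  assumes fin: "finite J" and j1: "j1 \<notin> J" and j2: "j2 \<notin> J" and j12: "j1 \<noteq> j2"
    and odd1: "odd (\<alpha> j1)" and odd2: "odd (\<alpha> j2)"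
    and units: "\<And>p::nat. prime p \<Longrightarrow> \<exists>i\<in>insert j1 (insert j2 J). \<exists>j\<in>insert j1 (insert j2 J).
      i \<noteq> j \<and> \<not> int p dvd \<alpha> i \<and> \<not> int p dvd \<alpha> j"
    and \<epsilon>2: "\<epsilon> j2 = 1" and \<epsilon>: "\<And>j. j \<in> J \<Longrightarrow> \<epsilon> j dvd 2"
  shows "\<exists>s r. s j1 = 1 \<and> s j2 = 0 \<and> r j2 = 1 \<and> (\<forall>j\<in>J. odd (s j) \<longleftrightarrow> j \<in> S) \<and>
    (\<Sum>i\<in>insert j1 (insert j2 J). \<alpha> i * s i * r i) = C \<and>
    (\<forall>p::nat. prime p \<longrightarrow> (\<exists>i\<in>insert j1 (insert j2 J). \<exists>j\<in>insert j1 (insert j2 J).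
       \<not> int p dvd (\<alpha> i * s i) * (\<alpha> j * \<epsilon> j * r j) - (\<alpha> j * s j) * (\<alpha> i * \<epsilon> i * r i)))"
proof -
  let ?I = "insert j1 (insert j2 J)"
  let ?good = "\<lambda>(p::nat) s r. \<exists>i\<in>?I. \<exists>j\<in>?I.
       \<not> int p dvd (\<alpha> i * s i) * (\<alpha> j * \<epsilon> j * r j) - (\<alpha> j * s j) * (\<alpha> i * \<epsilon> i * r i)"
  define N where "N = \<alpha> j1 * \<alpha> j2"
  have N: "N \<noteq> 0" "odd N" using odd1 odd2 by (auto simp: N_def)
  \<comment> \<open>For a prime outside \<open>P\<close> the minor at \<open>j1\<close>,
    \<open>j2\<close> is \<open>N\<close> itself, so only finitely many primes impose conditions. As
    \<open>N\<close> is odd, 2 is not among them and the parities of \<open>s\<close> can be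
    prescribed.\<close>
  define P where "P = {p::nat. prime p \<and> int p dvd N}"
  have "P \<subseteq> {..nat \<bar>N\<bar>}"
  proof
    fix p assume "p \<in> P"
    then have "int p dvd N" by (simp add: P_def)
    then have "int p \<le> \<bar>N\<bar>" using dvd_imp_le_int[OF N(1), of "int p"] by simp
    then show "p \<in> {..nat \<bar>N\<bar>}" by auto
  qed
  then have finP: "finite P" by (rule finite_subset) simp
  have not2: "2 \<notin> P" using N by (simp add: P_def)
  \<comment> \<open>The multiplicity is what divisibility by \<open>\<alpha> j1\<close> needs;
    \<open>Suc\<close> keeps the exponent positive, so that residues modulo \<open>p\<close> are
    also controlled when \<open>p\<close> does not divide \<open>\<alpha> j1\<close>.\<close>
  define k where "k p = Suc (multiplicity (int p) (\<alpha> j1))" for p :: nat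
  define loc where "loc p \<sigma> \<rho> \<longleftrightarrow>
    (int p dvd \<alpha> j1 \<longrightarrow> int p ^ k p dvd C - (\<Sum>j\<in>J. \<alpha> j * \<sigma> j * \<rho> j)) \<and>
    (\<forall>s r. s j1 = 1 \<and> s j2 = 0 \<and> r j2 = 1 \<and>
      (\<forall>j\<in>J. [s j = \<sigma> j] (mod int p) \<and> [r j = \<rho> j] (mod int p)) \<longrightarrow> ?good p s r)"
    for p and \<sigma> \<rho> :: "'i \<Rightarrow> int"
  have "\<exists>\<sigma> \<rho>. loc p \<sigma> \<rho>" if "p \<in> P" for p
    unfolding loc_def
  proof (rule exists_local_rows[OF fin _ j1 j2])
    show "prime p" "int p dvd \<alpha> j1 * \<alpha> j2" using that by (auto simp: P_def N_def)
    then show "\<exists>i\<in>?I. \<exists>j\<in>?I. i \<noteq> j \<and> \<not> int p dvd \<alpha> i \<and> \<not> int p dvd \<alpha> j"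
      using units by blast
    fix j assume "j \<in> insert j2 J"
    then have "\<epsilon> j dvd 2" using \<epsilon> \<epsilon>2 by auto
    moreover have "\<not> int p dvd 2"
    proof
      assume "int p dvd 2"
      then have "p dvd 2" by (metis int_dvd_int_iff of_nat_numeral)
      with \<open>prime p\<close> have "p = 2" by (simp add: primes_dvd_imp_eq)
      with that not2 show False by simp
    qed
    ultimately show "\<not> int p dvd \<epsilon> j" by (meson dvd_trans)
  qed
  then obtain \<sigma> \<rho> where loc: "\<And>p. p \<in> P \<Longrightarrow> loc p (\<sigma> p) (\<rho> p)" by metis
  have "\<exists>x. \<forall>p\<in>insert 2 P. [x = (if p = 2 then if j \<in> S then 1 else 0 else \<sigma> p j)] (mod int p ^ k p)" for j
    using finP by (intro chinese_remainder_prime_powers_int) (auto simp: P_def)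
  then obtain s0 where s0: "\<And>j p. p \<in> insert 2 P \<Longrightarrow>
      [s0 j = (if p = 2 then if j \<in> S then 1 else 0 else \<sigma> p j)] (mod int p ^ k p)" by metis
  have "\<exists>x. \<forall>p\<in>P. [x = \<rho> p j] (mod int p ^ k p)" for j
    using finP by (intro chinese_remainder_prime_powers_int) (auto simp: P_def)
  then obtain r0 where r0: "\<And>j p. p \<in> P \<Longrightarrow> [r0 j = \<rho> p j] (mod int p ^ k p)" by metis
  have s0P: "[s0 j = \<sigma> p j] (mod int p ^ k p)" if "p \<in> P" for p j
    using s0[of p j] that not2 by (cases "p = 2") auto
  have par: "odd (s0 j) \<longleftrightarrow> j \<in> S" for j
  proof -
    have "[s0 j = (if j \<in> S then 1 else 0)] (mod 2 ^ k 2)" using s0[of 2 j] by simp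
    then have "[s0 j = (if j \<in> S then 1 else 0)] (mod 2)"
      by (rule cong_dvd_modulus) (simp add: k_def)
    then show ?thesis by (auto simp: cong_def even_iff_mod_2_eq_zero split: if_splits)
  qed
  have "\<alpha> j1 dvd C - (\<Sum>j\<in>J. \<alpha> j * s0 j * r0 j)"
  proof (rule dvd_if_prime_powers_dvd_int)
    show "\<alpha> j1 \<noteq> 0" using odd1 by auto
    fix p :: nat assume p: "prime p" "int p dvd \<alpha> j1"
    then have pP: "p \<in> P" by (simp add: P_def N_def)
    have "[C - (\<Sum>j\<in>J. \<alpha> j * s0 j * r0 j) = C - (\<Sum>j\<in>J. \<alpha> j * \<sigma> p j * \<rho> p j)] (mod int p ^ k p)"
      using s0P[OF pP] r0[OF pP] by (intro cong_diff cong_sum cong_mult cong_refl)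
    then have "int p ^ k p dvd C - (\<Sum>j\<in>J. \<alpha> j * s0 j * r0 j)"
      using loc[OF pP] p(2) by (simp add: loc_def cong_dvd_iff)
    then show "int p ^ multiplicity (int p) (\<alpha> j1) dvd C - (\<Sum>j\<in>J. \<alpha> j * s0 j * r0 j)"
      by (rule dvd_trans[rotated]) (simp add: k_def)
  qed
  then obtain q where q: "C - (\<Sum>j\<in>J. \<alpha> j * s0 j * r0 j) = \<alpha> j1 * q" by (elim dvdE)
  define s where "s = s0(j1 := 1, j2 := 0)"
  define r where "r = r0(j1 := q, j2 := 1)"
  have sr: "s j1 = 1" "s j2 = 0" "r j2 = 1" "r j1 = q" using j12 by (auto simp: s_def r_def)
  have J: "s j = s0 j" "r j = r0 j" if "j \<in> J" for j using that j1 j2 by (auto simp: s_def r_def)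
  have "(\<Sum>i\<in>?I. \<alpha> i * s i * r i) = \<alpha> j1 * q + (\<Sum>j\<in>J. \<alpha> j * s j * r j)"
    using fin j1 j2 j12 sr by simp
  also have "(\<Sum>j\<in>J. \<alpha> j * s j * r j) = (\<Sum>j\<in>J. \<alpha> j * s0 j * r0 j)"
    using J by (intro sum.cong) auto
  finally have sum: "(\<Sum>i\<in>?I. \<alpha> i * s i * r i) = C" using q by simp
  have "?good p s r" if p: "prime p" for p
  proof (cases "p \<in> P")
    case True
    have "[s j = \<sigma> p j] (mod int p) \<and> [r j = \<rho> p j] (mod int p)" if "j \<in> J" for j
      using cong_dvd_modulus[OF s0P[OF True]] cong_dvd_modulus[OF r0[OF True]] J[OF that]
      by (simp add: k_def)
    with loc[OF True] sr show ?thesis unfolding loc_def by blast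
  next
    case False
    then have "\<not> int p dvd (\<alpha> j1 * s j1) * (\<alpha> j2 * \<epsilon> j2 * r j2) - (\<alpha> j2 * s j2) * (\<alpha> j1 * \<epsilon> j1 * r j1)"
      using p sr \<epsilon>2 by (simp add: P_def N_def)
    then show ?thesis by blast
  qed
  with sr sum J par show ?thesis by (intro exI[of _ s] exI[of _ r]) simp
qed

section \<open>Sums of squares of 2 by 2 matrices in coordinates\<close>

text \<open>The matrices are [[x, b], [c, t - x]], with sum [[p, q], [r, s]].\<close>

definition sum_of_squares_entries ::
    "'i set \<Rightarrow> ('i \<Rightarrow> int) \<Rightarrow> int \<Rightarrow> int \<Rightarrow> int \<Rightarrow> int \<Rightarrow> bool" where
  "sum_of_squares_entries I a p q r s \<longleftrightarrow> (\<exists>x b c t.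
     (\<Sum>i\<in>I. a i * (x i ^ 2 + b i * c i)) = p \<and>
     (\<Sum>i\<in>I. a i * (t i * b i)) = q \<and>
     (\<Sum>i\<in>I. a i * (t i * c i)) = r \<and>
     (\<Sum>i\<in>I. a i * ((t i - x i) ^ 2 + b i * c i)) = s)"

text \<open>Transposition commutes with squaring. This moves an odd entry from position (1,2) to
  (2,1).\<close>

lemma sum_of_squares_entries_transpose:
  "sum_of_squares_entries I a p q r s \<Longrightarrow> sum_of_squares_entries I a p r q s"
proof -
  assume "sum_of_squares_entries I a p q r s"
  then obtain x b c t where
    "(\<Sum>i\<in>I. a i * (x i ^ 2 + b i * c i)) = p" "(\<Sum>i\<in>I. a i * (t i * b i)) = q"
    "(\<Sum>i\<in>I. a i * (t i * c i)) = r" "(\<Sum>i\<in>I. a i * ((t i - x i) ^ 2 + b i * c i)) = s"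
    unfolding sum_of_squares_entries_def by blast
  then show ?thesis
    unfolding sum_of_squares_entries_def
    by (intro exI[of _ x] exI[of _ c] exI[of _ b] exI[of _ t]) (simp add: mult.commute[of "c _" "b _"])
qed

lemma universal_over_int_mat_2_iff:
  "universal_over_int_mat TYPE(2) m a \<longleftrightarrow> (\<forall>p q r s. sum_of_squares_entries {1..m} a p q r s)"
proof
  assume U: "universal_over_int_mat TYPE(2) m a"
  show "\<forall>p q r s. sum_of_squares_entries {1..m} a p q r s"
  proof (intro allI)
    fix p q r s
    obtain X :: "nat \<Rightarrow> int ^ 2 ^ 2" where X: "(vector [vector [p, q], vector [r, s]] :: int ^ 2 ^ 2)
        = (\<Sum>i=1..m. int_mat_scale (a i) (X i ** X i))"
      using U unfolding universal_over_int_mat_def by blast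
    have ent: "(vector [vector [p, q], vector [r, s]] :: int ^ 2 ^ 2) $ k $ l
        = (\<Sum>i=1..m. a i * (X i $ k $ 1 * X i $ 1 $ l + X i $ k $ 2 * X i $ 2 $ l))" for k l
      unfolding X by (simp add: int_mat_scale_def matrix_matrix_mult_def sum_2)
    show "sum_of_squares_entries {1..m} a p q r s"
      unfolding sum_of_squares_entries_def
      \<comment> \<open>The fourth unknown is the trace, since the off-diagonal entries of a square
        are the trace times those of the matrix.\<close>
      by (rule exI[of _ "\<lambda>i. X i $ 1 $ 1"], rule exI[of _ "\<lambda>i. X i $ 1 $ 2"],
          rule exI[of _ "\<lambda>i. X i $ 2 $ 1"], rule exI[of _ "\<lambda>i. X i $ 1 $ 1 + X i $ 2 $ 2"])
        (use ent[of 1 1] ent[of 1 2] ent[of 2 1] ent[of 2 2] in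
          \<open>simp add: algebra_simps power2_eq_square\<close>)
  qed
next
  assume R: "\<forall>p q r s. sum_of_squares_entries {1..m} a p q r s"
  show "universal_over_int_mat TYPE(2) m a"
    unfolding universal_over_int_mat_def
  proof (intro allI)
    fix A :: "int ^ 2 ^ 2"
    have "sum_of_squares_entries {1..m} a (A $ 1 $ 1) (A $ 1 $ 2) (A $ 2 $ 1) (A $ 2 $ 2)"
      using R by blast
    then obtain x b c t where eq:
      "(\<Sum>i=1..m. a i * (x i ^ 2 + b i * c i)) = A $ 1 $ 1"
      "(\<Sum>i=1..m. a i * (t i * b i)) = A $ 1 $ 2"
      "(\<Sum>i=1..m. a i * (t i * c i)) = A $ 2 $ 1"
      "(\<Sum>i=1..m. a i * ((t i - x i) ^ 2 + b i * c i)) = A $ 2 $ 2"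
      unfolding sum_of_squares_entries_def by blast
    define X :: "nat \<Rightarrow> int ^ 2 ^ 2"
      where "X i = vector [vector [x i, b i], vector [c i, t i - x i]]" for i
    have "(\<Sum>i=1..m. int_mat_scale (a i) (X i ** X i)) $ k $ l
        = (\<Sum>i=1..m. a i * (X i $ k $ 1 * X i $ 1 $ l + X i $ k $ 2 * X i $ 2 $ l))" for k l
      by (simp add: int_mat_scale_def matrix_matrix_mult_def sum_2)
    moreover have "X i $ 1 $ 1 = x i" "X i $ 1 $ 2 = b i" "X i $ 2 $ 1 = c i" "X i $ 2 $ 2 = t i - x i" for i
      by (simp_all add: X_def)
    ultimately have "A = (\<Sum>i=1..m. int_mat_scale (a i) (X i ** X i))"
      unfolding vec_eq_iff forall_2
      by (simp add: eq[symmetric])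
         (intro conjI sum.cong refl; simp add: power2_eq_square algebra_simps)
    then show "\<exists>X. A = (\<Sum>i=1..m. int_mat_scale (a i) (X i ** X i))" by blast
  qed
qed

section \<open>Sufficiency: representing a given matrix\<close>

text \<open>With \<open>t\<close> and \<open>c\<close> fixed, subtracting the diagonal equations
  leaves one linear equation for \<open>x\<close>; the equations for \<open>q\<close> and
  \<open>p\<close> are then linear in \<open>b\<close>. The common factor \<open>e\<close> of the
  \<open>a i * t i\<close> is divided out so that the minors can be coprime; it is 1, or 2 when all
  these products are even.\<close>

lemma sum_of_squares_entries_if_coprime_minors:
  fixes a t c u :: "'i \<Rightarrow> int"
  assumes fin: "finite I"
    and u: "\<And>i. i \<in> I \<Longrightarrow> a i * t i = e * u i"
    and minors: "\<And>k::nat. prime k \<Longrightarrow>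
      \<exists>i\<in>I. \<exists>j\<in>I. \<not> int k dvd u i * (a j * c j) - u j * (a i * c i)"
    and r: "e * (\<Sum>i\<in>I. u i * c i) = r" and q: "e dvd q"
    and D: "2 * e dvd p - s + (\<Sum>i\<in>I. a i * t i ^ 2)"
  shows "sum_of_squares_entries I a p q r s"
proof -
  obtain K where K: "p - s + (\<Sum>i\<in>I. a i * t i ^ 2) = 2 * e * K" using D by (elim dvdE)
  obtain q' where q': "q = e * q'" using q by (elim dvdE)
  \<comment> \<open>\<open>x\<close> comes before \<open>b\<close>, because its squares enter the
    right-hand side for \<open>p\<close>. Only the row \<open>u\<close> constrains it; the target 0
    of the other row is a free choice.\<close>
  obtain x where x: "(\<Sum>i\<in>I. u i * x i) = K"
    using coprime_minors_surj[OF fin minors, of K 0] by blast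
  obtain b where b: "(\<Sum>i\<in>I. u i * b i) = q'"
      "(\<Sum>i\<in>I. (a i * c i) * b i) = p - (\<Sum>i\<in>I. a i * x i ^ 2)"
    using coprime_minors_surj[OF fin minors] by blast
  have at: "(\<Sum>i\<in>I. a i * (t i * y i)) = e * (\<Sum>i\<in>I. u i * y i)" for y
    unfolding sum_distrib_left using u by (intro sum.cong) (auto simp: mult.assoc[symmetric])
  have p: "(\<Sum>i\<in>I. a i * (x i ^ 2 + b i * c i)) = p"
    using b(2) by (simp add: algebra_simps sum.distrib)
  have "(\<Sum>i\<in>I. a i * ((t i - x i) ^ 2 + b i * c i))
      = (\<Sum>i\<in>I. a i * (x i ^ 2 + b i * c i)) + (\<Sum>i\<in>I. a i * t i ^ 2) - 2 * (\<Sum>i\<in>I. a i * (t i * x i))"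
    by (simp add: algebra_simps sum.distrib sum_subtractf sum_distrib_left power2_eq_square)
  also have "\<dots> = s" unfolding p at x using K by simp
  finally have s: "(\<Sum>i\<in>I. a i * ((t i - x i) ^ 2 + b i * c i)) = s" .
  show ?thesis
    unfolding sum_of_squares_entries_def
    by (rule exI[of _ x], rule exI[of _ b], rule exI[of _ c], rule exI[of _ t])
      (simp only: p s at b(1) q' r simp_thms)
qed

text \<open>\<open>exists_global_rows\<close> supplies \<open>t\<close> and \<open>c\<close>; what
  remains is to make \<open>p - s\<close> plus the sum of the \<open>a i * t i ^ 2\<close> divisible
  by \<open>2 * e\<close>. The cases differ in how the parities of the traces achieve this.\<close>

lemma sum_of_squares_entries_if_local:
  fixes a :: "'i \<Rightarrow> int"
  assumes fin: "finite I"
    and units: "\<And>p::nat. prime p \<Longrightarrow> \<exists>i\<in>I. \<exists>j\<in>I. i \<noteq> j \<and> \<not> int p dvd a i \<and> \<not> int p dvd a j"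
    and three: "\<exists>i\<in>I. \<exists>j\<in>I. \<exists>k\<in>I. i \<noteq> j \<and> i \<noteq> k \<and> j \<noteq> k \<and>
       \<not> 4 dvd a i \<and> \<not> 4 dvd a j \<and> \<not> 4 dvd a k"
  shows "sum_of_squares_entries I a p q r s"
proof -
  obtain j1 j2 where j12: "j1 \<in> I" "j2 \<in> I" "j1 \<noteq> j2" "odd (a j1)" "odd (a j2)"
    using units[OF two_is_prime_nat] by auto
  define J where "J = I - {j1, j2}"
  have J: "finite J" "j1 \<notin> J" "j2 \<notin> J" and I: "I = insert j1 (insert j2 J)"
    using fin j12 by (auto simp: J_def)
  obtain j3 where j3: "j3 \<in> J" "\<not> 4 dvd a j3"
    using three unfolding J_def by blast
  have sumI: "(\<Sum>i\<in>I. f i) = f j1 + f j2 + f j3 + (\<Sum>i\<in>J - {j3}. f i)" for f :: "'i \<Rightarrow> int"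
    using J j12 j3 by (simp add: I sum.remove[of J j3 f])
  note rows = exists_global_rows[OF J j12(3), folded I]
  have std: "\<exists>s r. s j1 = 1 \<and> s j2 = 0 \<and> r j2 = 1 \<and> (\<forall>j\<in>J. odd (s j) \<longleftrightarrow> j \<in> S) \<and>
    (\<Sum>i\<in>I. a i * s i * r i) = C \<and>
    (\<forall>p::nat. prime p \<longrightarrow> (\<exists>i\<in>I. \<exists>j\<in>I.
       \<not> int p dvd (a i * s i) * (a j * r j) - (a j * s j) * (a i * r i)))" for S C
    using rows[of a "\<lambda>_. 1" S C] j12 units by simp
  have rep: "sum_of_squares_entries I a p q r s" if "even (p - s + (\<Sum>i\<in>I. a i * t i ^ 2))"
    "(\<Sum>i\<in>I. a i * t i * c i) = r"
    "\<And>p::nat. prime p \<Longrightarrow> \<exists>i\<in>I. \<exists>j\<in>I.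
       \<not> int p dvd (a i * t i) * (a j * c j) - (a j * t j) * (a i * c i)"
    for t c q r
    by (rule sum_of_squares_entries_if_coprime_minors[OF fin, where e = 1 and u = "\<lambda>i. a i * t i" and t = t and c = c])
      (use that in auto)
  have odd_offdiag: "sum_of_squares_entries I a p q r s"
    if ev: "even (p - s)" "\<And>j. j \<in> J \<Longrightarrow> even (a j)" and "odd r" for q r
  proof -
    \<comment> \<open>Here \<open>r'\<close> serves as traces and \<open>s'\<close> as lower left
      entries. Modulo 2 only the \<open>j1\<close> term of the sum for \<open>r\<close> survives, so
      \<open>r' j1\<close> is odd like \<open>r' j2\<close>, and the two odd coefficients cancel in
      parity.\<close>
    obtain s' r' where sr: "s' j1 = 1" "s' j2 = 0" "r' j2 = 1"
      "(\<Sum>i\<in>I. a i * s' i * r' i) = r"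
      and minor: "\<And>p::nat. prime p \<Longrightarrow> \<exists>i\<in>I. \<exists>j\<in>I.
       \<not> int p dvd (a i * s' i) * (a j * r' j) - (a j * s' j) * (a i * r' i)"
      using std[of "{}" r] by auto
    have "even (\<Sum>i\<in>J - {j3}. a i * s' i * r' i)" using ev by (intro dvd_sum) auto
    then have "odd (r' j1)" using \<open>odd r\<close> sr j12 ev(2)[OF j3(1)] unfolding sumI by auto
    moreover have "even (\<Sum>i\<in>J - {j3}. a i * r' i ^ 2)" using ev by (intro dvd_sum) auto
    ultimately have "even (p - s + (\<Sum>i\<in>I. a i * r' i ^ 2))"
      unfolding sumI using ev(1) ev(2)[OF j3(1)] j12 sr by simp
    then show ?thesis
    proof (rule rep)
      show "(\<Sum>i\<in>I. a i * r' i * s' i) = r" using sr(4) by (simp add: mult_ac)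
      show "\<exists>i\<in>I. \<exists>j\<in>I. \<not> int k dvd (a i * r' i) * (a j * s' j) - (a j * r' j) * (a i * s' i)"
        if "prime k" for k
        using minor[OF that] by (metis mult.commute)
    qed
  qed
  \<comment> \<open>The parity of the sum of the \<open>a i * t i\<close> must be that of p - s. If only two coefficients are odd
    and p - s is even, both traces there are even or both are odd; the latter is obtained by
    exchanging the roles of t and c, which needs an odd entry outside the diagonal.\<close>
  consider "odd (p - s)" | j where "even (p - s)" "j \<in> J" "odd (a j)"
    | "even (p - s)" "\<And>j. j \<in> J \<Longrightarrow> even (a j)" "odd r \<or> odd q"
    | "even (p - s)" "even q" "even r" "4 dvd p - s"
    | "\<And>j. j \<in> J \<Longrightarrow> even (a j)" "even (p - s)" "even q" "even r" "\<not> 4 dvd p - s"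
    by blast
  then show ?thesis
  proof cases
    case 1
    \<comment> \<open>The only odd trace is at \<open>j1\<close>, so the weighted sum of squared
      traces is odd, as \<open>p - s\<close> is.\<close>
    obtain s' r' where sr: "s' j1 = 1" "s' j2 = 0" "\<forall>j\<in>J. even (s' j)"
      "(\<Sum>i\<in>I. a i * s' i * r' i) = r"
      and minor: "\<And>p::nat. prime p \<Longrightarrow> \<exists>i\<in>I. \<exists>j\<in>I.
       \<not> int p dvd (a i * s' i) * (a j * r' j) - (a j * s' j) * (a i * r' i)"
      using std[of "{}" r] by auto
    have "even (\<Sum>i\<in>J - {j3}. a i * s' i ^ 2)" using sr by (intro dvd_sum) auto
    then have "even (p - s + (\<Sum>i\<in>I. a i * s' i ^ 2))"
      unfolding sumI using 1 sr j12 j3 by simp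
    then show ?thesis by (rule rep) (use sr minor in auto)
  next
    case 2
    \<comment> \<open>A second odd trace, at the odd coefficient \<open>a j\<close>, makes that sum
      even.\<close>
    obtain s' r' where sr: "s' j1 = 1" "s' j2 = 0" "\<forall>i\<in>J. odd (s' i) \<longleftrightarrow> i = j"
      "(\<Sum>i\<in>I. a i * s' i * r' i) = r"
      and minor: "\<And>p::nat. prime p \<Longrightarrow> \<exists>i\<in>I. \<exists>j\<in>I.
       \<not> int p dvd (a i * s' i) * (a j * r' j) - (a j * s' j) * (a i * r' i)"
      using std[of "{j}" r] by auto
    have "even (\<Sum>i\<in>J - {j}. a i * s' i ^ 2)" using sr by (intro dvd_sum) auto
    moreover have "(\<Sum>i\<in>I. a i * s' i ^ 2) = a j1 + a j * s' j ^ 2 + (\<Sum>i\<in>J - {j}. a i * s' i ^ 2)"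
      using J j12 2 sr by (simp add: I sum.remove[of J j])
    ultimately have "even (p - s + (\<Sum>i\<in>I. a i * s' i ^ 2))"
      using 2 sr j12 by simp
    then show ?thesis by (rule rep) (use sr minor in auto)
  next
    case 3
    then show ?thesis
      using odd_offdiag sum_of_squares_entries_transpose by metis
  next
    case 4
    \<comment> \<open>The traces are \<open>2 * s'\<close>, with \<open>e = 2\<close>: the equation
      for \<open>r\<close> is halved and all squared traces vanish modulo 4.\<close>
    obtain s' r' where sr: "(\<Sum>i\<in>I. a i * s' i * r' i) = r div 2"
      and minor: "\<And>p::nat. prime p \<Longrightarrow> \<exists>i\<in>I. \<exists>j\<in>I.
       \<not> int p dvd (a i * s' i) * (a j * r' j) - (a j * s' j) * (a i * r' i)"
      using std[of "{}" "r div 2"] by auto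
    show ?thesis
    proof (rule sum_of_squares_entries_if_coprime_minors[OF fin])
      show "2 * (\<Sum>i\<in>I. a i * s' i * r' i) = r" using sr 4 by simp
      show "a i * (2 * s' i) = 2 * (a i * s' i)" for i by simp
      have "4 dvd (\<Sum>i\<in>I. a i * (2 * s' i) ^ 2)"
        by (intro dvd_sum) (simp add: power_mult_distrib)
      with 4 show "2 * 2 dvd p - s + (\<Sum>i\<in>I. a i * (2 * s' i) ^ 2)" by simp
    qed (use minor 4 in auto)
  next
    case 5
    obtain w where w: "a j3 = 2 * w" using 5(1)[OF j3(1)] by (elim evenE)
    have oddw: "odd w" using j3 w by auto
    \<comment> \<open>The row \<open>u\<close> is to be \<open>\<alpha> i * s' i\<close>, with the 2
      of \<open>a j3\<close> moved into \<open>e\<close>; the row \<open>a i * c i\<close> keeps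
      this 2, as \<open>\<epsilon>\<close>.\<close>
    define \<alpha> where "\<alpha> = a(j3 := w)"
    define \<epsilon> :: "'i \<Rightarrow> int" where "\<epsilon> = (\<lambda>_. 1)(j3 := 2)"
    have ne: "j3 \<noteq> j1" "j3 \<noteq> j2" using J j3 by auto
    have a: "a i = \<alpha> i * \<epsilon> i" for i by (simp add: \<alpha>_def \<epsilon>_def w)
    have "\<exists>i\<in>I. \<exists>j\<in>I. i \<noteq> j \<and> \<not> int p dvd \<alpha> i \<and> \<not> int p dvd \<alpha> j" if "prime p" for p
      using units[OF that] unfolding a by (meson dvd_mult2)
    moreover have "odd (\<alpha> j1)" "odd (\<alpha> j2)" "\<epsilon> j2 = 1" "\<And>j. \<epsilon> j dvd 2"
      using j12 ne by (auto simp: \<alpha>_def \<epsilon>_def)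
    ultimately obtain s' r' where sr: "\<forall>i\<in>J. odd (s' i) \<longleftrightarrow> i = j3"
      "(\<Sum>i\<in>I. \<alpha> i * s' i * r' i) = r div 2"
      and minor: "\<And>p::nat. prime p \<Longrightarrow> \<exists>i\<in>I. \<exists>j\<in>I.
       \<not> int p dvd (\<alpha> i * s' i) * (\<alpha> j * \<epsilon> j * r' j) - (\<alpha> j * s' j) * (\<alpha> i * \<epsilon> i * r' i)"
      using rows[of \<alpha> \<epsilon> "{j3}" "r div 2"] by auto
    \<comment> \<open>The trace at \<open>j3\<close> stays odd: its coefficient already provides the
      factor \<open>e = 2\<close>, which the other traces must provide themselves.\<close>
    define t where "t = (\<lambda>i. if i = j3 then s' i else 2 * s' i)"
    show ?thesis
    proof (rule sum_of_squares_entries_if_coprime_minors[OF fin])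
      show "2 * (\<Sum>i\<in>I. \<alpha> i * s' i * r' i) = r" using sr 5 by simp
      show "a i * t i = 2 * (\<alpha> i * s' i)" for i by (simp add: t_def \<alpha>_def w)
      show "\<exists>i\<in>I. \<exists>j\<in>I. \<not> int p dvd \<alpha> i * s' i * (a j * r' j) - \<alpha> j * s' j * (a i * r' i)"
        if "prime p" for p using minor[OF that] by (simp add: a)
      have d1: "4 dvd (\<Sum>i\<in>J - {j3}. a i * t i ^ 2)"
        by (intro dvd_sum) (simp add: t_def power_mult_distrib)
      have d2: "4 dvd a j1 * t j1 ^ 2" "4 dvd a j2 * t j2 ^ 2"
        using ne by (simp_all add: t_def power_mult_distrib)
      \<comment> \<open>Both summands are 2 modulo 4.\<close>
      have d3: "4 dvd p - s + a j3 * t j3 ^ 2"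
      proof -
        obtain k where k: "p - s = 2 * k" using 5 by (elim evenE)
        with 5 have "odd k" by auto
        then have "even (k + w * s' j3 ^ 2)" using oddw sr j3 by simp
        then have "2 * 2 dvd 2 * (k + w * s' j3 ^ 2)" by (subst dvd_mult_cancel_left) simp
        moreover have "p - s + a j3 * t j3 ^ 2 = 2 * (k + w * s' j3 ^ 2)"
          by (simp add: k w t_def algebra_simps)
        ultimately show ?thesis by simp
      qed
      show "2 * 2 dvd p - s + (\<Sum>i\<in>I. a i * t i ^ 2)"
        unfolding sumI using dvd_add[OF d3 dvd_add[OF dvd_add[OF d2] d1]] by (simp add: algebra_simps)
    qed (use 5 in auto)
  qed
qed

section \<open>Necessity: matrices that are not represented\<close>

text \<open>Modulo \<open>p\<close> one square remains. The entry 1 makes its coefficient and trace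
  units, so \<open>c\<close> vanishes; then both diagonal entries vanish, hence also the trace, a
  contradiction.\<close>

lemma nilpotent_not_sum_of_squares_entries:
  fixes a :: "'i \<Rightarrow> int"
  assumes fin: "finite I" and i0: "i0 \<in> I" and p: "prime p"
    and dvd: "\<And>i. i \<in> I \<Longrightarrow> i \<noteq> i0 \<Longrightarrow> int p dvd a i"
  shows "\<not> sum_of_squares_entries I a 0 1 0 0"
proof
  assume "sum_of_squares_entries I a 0 1 0 0"
  then obtain x b c t where eq:
     "(\<Sum>i\<in>I. a i * (x i ^ 2 + b i * c i)) = 0"
     "(\<Sum>i\<in>I. a i * (t i * b i)) = 1"
     "(\<Sum>i\<in>I. a i * (t i * c i)) = 0"
     "(\<Sum>i\<in>I. a i * ((t i - x i) ^ 2 + b i * c i)) = 0"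
    unfolding sum_of_squares_entries_def by blast
  have pi: "prime (int p)" using p by simp
  have red: "int p dvd a i0 * f i0 - z" if "(\<Sum>i\<in>I. a i * f i) = z" for f z
  proof -
    have "int p dvd (\<Sum>i\<in>I - {i0}. a i * f i)" using dvd by (intro dvd_sum) auto
    moreover have "a i0 * f i0 - z = - (\<Sum>i\<in>I - {i0}. a i * f i)"
      using that sum.remove[OF fin i0, of "\<lambda>i. a i * f i"] by simp
    ultimately show ?thesis by simp
  qed
  have "int p dvd a i0 * (t i0 * b i0) - 1" by (rule red[OF eq(2)])
  then have "\<not> int p dvd a i0 * (t i0 * b i0)"
    using pi by (metis dvd_diff_right_iff not_prime_unit)
  then have nd: "\<not> int p dvd a i0" "\<not> int p dvd t i0" by auto
  then have "int p dvd c i0" using red[OF eq(3)] by (simp add: prime_dvd_mult_iff[OF pi])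
  moreover have "int p dvd x i0 ^ 2 + b i0 * c i0" "int p dvd (t i0 - x i0) ^ 2 + b i0 * c i0"
    using red[OF eq(1)] red[OF eq(4)] nd by (simp_all add: prime_dvd_mult_iff[OF pi])
  ultimately have "int p dvd x i0" "int p dvd t i0 - x i0"
    using pi by (simp_all add: dvd_add_left_iff prime_dvd_power_iff)
  with nd show False by (metis diff_add_cancel dvd_add)
qed

text \<open>The difference of the diagonal equations gives \<open>t\<close> and \<open>t'\<close>
  equal parity. If both are even, it says that 4 divides 2. If both are odd, the off-diagonal
  equations make \<open>b\<close>, \<open>b'\<close> and \<open>c\<close>, \<open>c'\<close> agree
  modulo 2; then \<open>d1\<close> gives h = x + y modulo 2, and half the difference gives h = x + y
  + 1.\<close>

lemma two_odd_squares_mod_4: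
  fixes u v h x y b c b' c' t t' :: int
  assumes odd: "odd u" "odd v" and h: "u + v = 2 * h"
    and d1: "4 dvd u * (x\<^sup>2 + b * c) + v * (y\<^sup>2 + b' * c') - h"
    and d2: "4 dvd u * (t * b) + v * (t' * b')"
    and d3: "4 dvd u * (t * c) + v * (t' * c')"
    and d4: "4 dvd u * ((t - x)\<^sup>2 + b * c) + v * ((t' - y)\<^sup>2 + b' * c') - (h + 2)"
  shows False
proof -
  have "4 dvd u * (t * (2 * x - t)) + v * (t' * (2 * y - t')) + 2"
    using dvd_diff[OF d1 d4] by (simp add: algebra_simps power2_eq_square)
  then obtain K where K: "u * (t * (2 * x - t)) + v * (t' * (2 * y - t')) + 2 = 4 * K" by (elim dvdE)
  have "even (u * (t * (2 * x - t)) + v * (t' * (2 * y - t')) + 2)" unfolding K by simp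
  then have par: "even t \<longleftrightarrow> even t'" using odd by simp
  show False
  proof (cases "even t")
    case True
    then obtain k k' where "t = 2 * k" "t' = 2 * k'" using par by (metis evenE)
    then have "2 = 4 * (K - u * (k * (x - k)) - v * (k' * (y - k')))"
      using K by (simp add: algebra_simps)
    then show False by presburger
  next
    case False
    then obtain k k' where k: "t = 2 * k + 1" "t' = 2 * k' + 1" using par by (metis oddE)
    have ev: "even z" if "4 dvd z" for z :: int using that by presburger
    have bc: "even b \<longleftrightarrow> even b'" "even c \<longleftrightarrow> even c'"
      using ev[OF d2] ev[OF d3] odd k by auto
    have "even h \<longleftrightarrow> even (x + y)" using ev[OF d1] odd bc by auto
    \<comment> \<open>An odd square is 1 + 4 k (k + 1), so the squared traces contribute u + v = 2 h
      modulo 4. Hence the choice of \<open>h\<close>: the equation can be halved with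
      \<open>h\<close> in it.\<close>
    moreover have "4 * K = 2 * (u * t * x + v * t' * y - h + 1) - 4 * (u * k * (k + 1) + v * k' * (k' + 1))"
    proof -
      have "4 * K = 2 * (u * t * x + v * t' * y) - (u + v) + 2 - 4 * (u * k * (k + 1) + v * k' * (k' + 1))"
        unfolding K[symmetric] k by (simp add: algebra_simps)
      then show ?thesis using h by simp
    qed
    then have "u * t * x + v * t' * y - h + 1 = 2 * (K + (u * k * (k + 1) + v * k' * (k' + 1)))" by simp
    then have "even (u * t * x + v * t' * y - h + 1)" by (metis dvd_triv_left)
    ultimately show False using odd k by auto
  qed
qed

lemma diagonal_not_sum_of_squares_entries:
  fixes a :: "'i \<Rightarrow> int"
  assumes fin: "finite I" and ij: "i \<in> I" "j \<in> I" "i \<noteq> j" and odd: "odd (a i)" "odd (a j)"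
    and dvd: "\<And>k. k \<in> I \<Longrightarrow> k \<noteq> i \<Longrightarrow> k \<noteq> j \<Longrightarrow> 4 dvd a k"
    and h: "a i + a j = 2 * h"
  shows "\<not> sum_of_squares_entries I a h 0 0 (h + 2)"
proof
  assume "sum_of_squares_entries I a h 0 0 (h + 2)"
  then obtain x b c t where eq:
     "(\<Sum>i\<in>I. a i * (x i ^ 2 + b i * c i)) = h"
     "(\<Sum>i\<in>I. a i * (t i * b i)) = 0"
     "(\<Sum>i\<in>I. a i * (t i * c i)) = 0"
     "(\<Sum>i\<in>I. a i * ((t i - x i) ^ 2 + b i * c i)) = h + 2"
    unfolding sum_of_squares_entries_def by blast
  have red: "4 dvd a i * f i + a j * f j - z" if "(\<Sum>i\<in>I. a i * f i) = z" for f z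
  proof -
    have "4 dvd (\<Sum>k\<in>I - {i} - {j}. a k * f k)" using dvd by (intro dvd_sum) auto
    moreover have "a i * f i + a j * f j - z = - (\<Sum>k\<in>I - {i} - {j}. a k * f k)"
      using that sum.remove[OF fin ij(1), of "\<lambda>i. a i * f i"] ij fin
        sum.remove[of "I - {i}" j "\<lambda>i. a i * f i"] by simp
    ultimately show ?thesis by simp
  qed
  show False
    using two_odd_squares_mod_4[OF odd h red[OF eq(1)] _ _ red[OF eq(4)]] red[OF eq(2)] red[OF eq(3)]
    by simp
qed

section \<open>Counting indices, and the equivalence\<close>

text \<open>Complementation in \<open>{1..m}\<close>: at most one index escapes \<open>d\<close>. As
  m >= 1, the subtraction on \<open>nat\<close> is exact.\<close>

lemma card_dvd_ge_iff:
  fixes a :: "nat \<Rightarrow> int"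
  assumes "m \<ge> 1"
  shows "card {i \<in> {1..m}. d dvd a i} \<ge> m - 1 \<longleftrightarrow>
    \<not> (\<exists>i\<in>{1..m}. \<exists>j\<in>{1..m}. i \<noteq> j \<and> \<not> d dvd a i \<and> \<not> d dvd a j)"
proof -
  let ?U = "{i \<in> {1..m}. \<not> d dvd a i}"
  have "{i \<in> {1..m}. d dvd a i} \<union> ?U = {1..m}" by auto
  then have "card {i \<in> {1..m}. d dvd a i} + card ?U = m"
    by (subst card_Un_disjoint[symmetric]) auto
  then have "card {i \<in> {1..m}. d dvd a i} \<ge> m - 1 \<longleftrightarrow> card ?U \<le> Suc 0"
    using assms by linarith
  also have "card ?U \<le> Suc 0 \<longleftrightarrow> (\<forall>i\<in>?U. \<forall>j\<in>?U. i = j)" by (rule card_le_Suc0_iff_eq) simp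
  finally show ?thesis by blast
qed

theorem theorem2p1:
  fixes m :: nat and a :: "nat \<Rightarrow> int"
  assumes "m \<ge> 1"
  shows "universal_over_int_mat TYPE(2) m a \<longleftrightarrow>
    \<not> (\<exists>p::nat. prime p \<and> card {i \<in> {1..m}. int p dvd a i} \<ge> m - 1) \<and>
    (\<exists>i\<in>{1..m}. \<exists>j\<in>{1..m}. \<exists>k\<in>{1..m}. i \<noteq> j \<and> i \<noteq> k \<and> j \<noteq> k \<and>
       \<not> 4 dvd a i \<and> \<not> 4 dvd a j \<and> \<not> 4 dvd a k)"
  unfolding card_dvd_ge_iff[OF assms] universal_over_int_mat_2_iff
proof (intro iffI conjI)
  assume U: "\<forall>p q r s. sum_of_squares_entries {1..m} a p q r s"
  show units: "\<not> (\<exists>p::nat. prime p \<and>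
    \<not> (\<exists>i\<in>{1..m}. \<exists>j\<in>{1..m}. i \<noteq> j \<and> \<not> int p dvd a i \<and> \<not> int p dvd a j))"
  proof
    assume "\<exists>p::nat. prime p \<and>
      \<not> (\<exists>i\<in>{1..m}. \<exists>j\<in>{1..m}. i \<noteq> j \<and> \<not> int p dvd a i \<and> \<not> int p dvd a j)"
    then obtain p :: nat where p: "prime p"
      "\<And>i j. i \<in> {1..m} \<Longrightarrow> j \<in> {1..m} \<Longrightarrow> i \<noteq> j \<Longrightarrow> int p dvd a i \<or> int p dvd a j"
      by blast
    \<comment> \<open>If some coefficient is not divisible by \<open>p\<close>, its index is
      \<open>i0\<close>; otherwise any index will do, and 1 is one since m >= 1.\<close>
    have "\<exists>i0\<in>{1..m}. \<forall>i\<in>{1..m}. i \<noteq> i0 \<longrightarrow> int p dvd a i"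
    proof (cases "\<forall>i\<in>{1..m}. int p dvd a i")
      case True
      then show ?thesis using assms by (intro bexI[of _ 1]) auto
    qed (use p(2) in blast)
    then obtain i0 where "i0 \<in> {1..m}" "\<And>i. i \<in> {1..m} \<Longrightarrow> i \<noteq> i0 \<Longrightarrow> int p dvd a i" by blast
    with U p(1) show False using nilpotent_not_sum_of_squares_entries[of "{1..m}" i0 p a] by blast
  qed
  \<comment> \<open>Condition (i) at the prime 2 gives two odd coefficients; the third index comes
    from the representability of diag(h, h + 2).\<close>
  obtain i j where ij: "i \<in> {1..m}" "j \<in> {1..m}" "i \<noteq> j" "odd (a i)" "odd (a j)"
    using units two_is_prime_nat by (metis of_nat_numeral)
  then obtain h where h: "a i + a j = 2 * h" by (metis evenE odd_even_add)
  obtain k where k: "k \<in> {1..m}" "k \<noteq> i" "k \<noteq> j" "\<not> 4 dvd a k"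
    using diagonal_not_sum_of_squares_entries[of "{1..m}" i j a h] ij h U by blast
  have "\<not> 4 dvd a i" "\<not> 4 dvd a j" using ij by presburger+
  with k ij show "\<exists>i\<in>{1..m}. \<exists>j\<in>{1..m}. \<exists>k\<in>{1..m}. i \<noteq> j \<and> i \<noteq> k \<and> j \<noteq> k \<and>
       \<not> 4 dvd a i \<and> \<not> 4 dvd a j \<and> \<not> 4 dvd a k" by metis
next
  assume "\<not> (\<exists>p::nat. prime p \<and>
    \<not> (\<exists>i\<in>{1..m}. \<exists>j\<in>{1..m}. i \<noteq> j \<and> \<not> int p dvd a i \<and> \<not> int p dvd a j)) \<and>
    (\<exists>i\<in>{1..m}. \<exists>j\<in>{1..m}. \<exists>k\<in>{1..m}. i \<noteq> j \<and> i \<noteq> k \<and> j \<noteq> k \<and>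
       \<not> 4 dvd a i \<and> \<not> 4 dvd a j \<and> \<not> 4 dvd a k)"
  then show "\<forall>p q r s. sum_of_squares_entries {1..m} a p q r s"
    using sum_of_squares_entries_if_local[of "{1..m}" a] by blast
qed

end
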